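(* Let $y$ be a nonnegative integer that is not a Zumkeller number. Then $$\mathrm{Ulam}[y]=\{(x,z)\in\mathbb{N}^2 : x+z\equiv 1 \pmod 2 \text{ and } \text{c-Ulam}[y](x,z)=1\}.$$
   Context: $\mathbb{N}=\{0,1,2,\dots\}$. Ulam words are binary words defined recursively: $\mathcal{U}(1)=\{0,1\}$, and for $n>1$, $\mathcal{U}(n)$ is the set of all words of length $n$ over $\{0,1\}$ that are expressible uniquely as a concatenation $uv$ of two distinct words $u\in\mathcal{U}(i)$, $v\in\mathcal{U}(j)$ with $i,j<n$ (i.e. there is exactly one ordered pair $(u,v)$ of such words, $u\ne v$). A word is Ulam if it belongs to $\bigcup_{n\ge1}\mathcal{U}(n)$. $0^m$ denotes a block of $m$ zeros. $\mathrm{Ulam}[y]\subset\mathbb{N}^2$ is the set of $(x,z)$ such that the word $0^x10^y10^z$ is Ulam. The labeling $\text{c-Ulam}[y]:\mathbb{N}^2\to\{0,1,2\}$ is defined by letting $\text{c-Ulam}[y](x,z)$ be the minimum of $2$ and the number of representations of $0^x10^y10^z$ as a concatenation of two (not necessarily distinct) Ulam words with exactly one $1$ each, i.e. the number of integers $a$, $0\le a\le y$, such that both $0^x10^a$ and $0^{y-a}10^z$ are Ulam. A positive integer is a Zumkeller number if it has at most one $0$ in its binary representation. *)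

theory Defs
  imports "HOL-Library.Log_Nat" "HOL-Number_Theory.Cong"
begin

text \<open>Binary words are lists of booleans: \<open>False\<close> is the letter 0 and \<open>True\<close> the letter 1.\<close>

type_synonym word = "bool list"

text \<open>The index 0, for which the recursion says nothing, gets the empty set; hence the indices
  \<open>i < n\<close>, \<open>j < n\<close> below effectively range over the positive integers less than \<open>n\<close>.\<close>

function ulam_words :: "nat \<Rightarrow> word set" where
  "ulam_words n =
    (if n = 0 then {}
     else if n = 1 then {[False], [True]}
     else {w. length w = n \<and>
              (\<exists>!p. (\<exists>i\<in>{..<n}. fst p \<in> ulam_words i) \<and> (\<exists>j\<in>{..<n}. snd p \<in> ulam_words j) \<and>
                    fst p \<noteq> snd p \<and> w = fst p @ snd p)})"
  by auto
termination by (relation "measure id") auto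

declare ulam_words.simps [simp del]

definition is_ulam :: "word \<Rightarrow> bool" where
  "is_ulam w \<longleftrightarrow> (\<exists>n\<ge>1. w \<in> ulam_words n)"

definition two_ones :: "nat \<Rightarrow> nat \<Rightarrow> nat \<Rightarrow> word" where
  "two_ones x y z = replicate x False @ [True] @ replicate y False @ [True] @ replicate z False"

definition Ulam :: "nat \<Rightarrow> (nat \<times> nat) set" where
  "Ulam y = {(x, z). is_ulam (two_ones x y z)}"

definition c_Ulam :: "nat \<Rightarrow> nat \<times> nat \<Rightarrow> nat" where
  "c_Ulam y = (\<lambda>(x, z). min 2 (card {(u, v). is_ulam u \<and> is_ulam v \<and>
      count_list u True = 1 \<and> count_list v True = 1 \<and> u @ v = two_ones x y z}))"

text \<open>The binary digits of \<open>n > 0\<close> are those at positions \<open>0, \<dots>, floorlog 2 n - 1\<close>, the last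
  being the leading 1.\<close>

definition zumkeller :: "nat \<Rightarrow> bool" where
  "zumkeller n \<longleftrightarrow> n > 0 \<and> card {i. i < floorlog 2 n \<and> \<not> bit n i} \<le> 1"

end

theory Submission
  imports Defs
begin

text \<open>
  A word \<open>0\<^sup>x10\<^sup>z\<close> can only be split by removing an outer zero, which gives an exclusive-or
  recursion of Pascal type; hence it is Ulam iff the binary expansions of \<open>x\<close> and \<open>z\<close> are
  disjoint. Let \<open>N(x, z)\<close> be the number of \<open>a \<le> y\<close> such that \<open>x\<close>, \<open>a\<close> and \<open>y - a\<close>, \<open>z\<close> are
  disjoint pairs; halving all arguments gives recursions for \<open>N\<close>. The word \<open>0\<^sup>x10\<^sup>y10\<^sup>z\<close> has
  \<open>N(x, z)\<close> splittings into words with a single 1, and possibly one more at either end, removing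
  an outer zero. The theorem follows by induction on \<open>x + z\<close>. If \<open>x + z\<close> is odd, the end
  splittings fail by induction. If it is even, \<open>N(x, z) = 0\<close> forces \<open>N(x - 1, z) = N(x, z - 1)\<close>,
  so the end splittings occur together, while \<open>N(x, z) = 1\<close> forces one of them to occur; in no
  case is the total 1. The only splitting spoiled by the condition \<open>u \<noteq> v\<close> occurs for disjoint
  \<open>x\<close>, \<open>z\<close> with \<open>x + z = y\<close>. There \<open>N(x, z)\<close> exceeds the number of zero digits of \<open>y\<close>, so for
  \<open>y > 0\<close> not a Zumkeller number at least two splittings remain.\<close>

section \<open>Disjoint binary expansions\<close>

definition disj_bits :: "nat \<Rightarrow> nat \<Rightarrow> bool" where
  "disj_bits x z \<longleftrightarrow> and x z = 0"

lemma disj_bits_commute: "disj_bits x z \<longleftrightarrow> disj_bits z x"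
  by (simp add: disj_bits_def and.commute)

lemma disj_bits_0 [simp]: "disj_bits 0 z" "disj_bits x 0"
  by (simp_all add: disj_bits_def)

lemma disj_bits_double [simp]:
  "disj_bits (2 * x) (2 * z) \<longleftrightarrow> disj_bits x z"
  "disj_bits (Suc (2 * x)) (2 * z) \<longleftrightarrow> disj_bits x z"
  "disj_bits (2 * x) (Suc (2 * z)) \<longleftrightarrow> disj_bits x z"
  "\<not> disj_bits (Suc (2 * x)) (Suc (2 * z))"
  unfolding disj_bits_def by (subst and_nat_unfold, simp)+

lemma nat_parity_cases:
  obtains m where "n = 2 * m" | m where "n = Suc (2 * m)"
  by (metis evenE oddE Suc_eq_plus1)

text \<open>Restores a doubled form so that the halving rules match; \<open>mult_Suc_right\<close>
  would undo this, hence its removal below.\<close>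

lemma double_Suc: "Suc (Suc (2 * k)) = 2 * Suc k"
  by simp

text \<open>Pascal's rule modulo 2: disjointness means that the binomial coefficient of
  \<open>x + z\<close> over \<open>x\<close> is odd. Halving settles every parity case at once
  except both odd, where all three terms halve to the same claim.\<close>

lemma disj_bits_pascal:
  "disj_bits (Suc x) (Suc z) \<longleftrightarrow> disj_bits x (Suc z) \<noteq> disj_bits (Suc x) z"
proof (induction x arbitrary: z rule: less_induct)
  case (less x)
  consider (ee) m n where "x = 2 * m" "z = 2 * n" | (eo) m n where "x = 2 * m" "z = Suc (2 * n)"
    | (oe) m n where "x = Suc (2 * m)" "z = 2 * n" | (oo) m n where "x = Suc (2 * m)" "z = Suc (2 * n)"
    by (metis nat_parity_cases)
  then show ?case
  proof cases
    case oo
    from less [of m n] oo show ?thesis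
      unfolding oo double_Suc disj_bits_double by simp
  next
    case ee
    then show ?thesis by simp
  next
    case eo
    from eo show ?thesis unfolding eo double_Suc disj_bits_double by simp
  next
    case oe
    from oe show ?thesis unfolding oe double_Suc disj_bits_double by simp
  qed
qed

section \<open>Counting complementary splittings\<close>

definition splits :: "nat \<Rightarrow> nat \<Rightarrow> nat \<Rightarrow> nat" where
  "splits y x z = card {a. a \<le> y \<and> disj_bits x a \<and> disj_bits (y - a) z}"

lemma finite_splits: "finite {a. a \<le> (y::nat) \<and> P a}"
  by (rule finite_subset [of _ "{..y}"]) auto

lemma card_Collect_parity:
  fixes P :: "nat \<Rightarrow> bool"
  assumes "finite {a. P a}"
  shows "card {a. P a} = card {a. P (2 * a)} + card {a. P (Suc (2 * a))}"
proof -
  have eq: "{a. P a} = (*) 2 ` {a. P (2 * a)} \<union> (\<lambda>a. Suc (2 * a)) ` {a. P (Suc (2 * a))}" (is "_ = ?A \<union> ?B")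
    by (auto simp: image_iff) (metis nat_parity_cases)
  have fin: "finite ?A" "finite ?B"
    using assms eq by (metis finite_Un)+
  have "?A \<inter> ?B = {}"
    by auto presburger
  with fin have "card {a. P a} = card ?A + card ?B"
    using card_Un_disjoint eq by metis
  moreover have "card ?A = card {a. P (2 * a)}" "card ?B = card {a. P (Suc (2 * a))}"
    by (rule card_image; auto simp: inj_on_def)+
  ultimately show ?thesis by simp
qed

section \<open>Recursions for the count under halving\<close>

lemma splits_parity:
  "splits y x z = card {a. 2 * a \<le> y \<and> disj_bits x (2 * a) \<and> disj_bits (y - 2 * a) z}
     + card {a. Suc (2 * a) \<le> y \<and> disj_bits x (Suc (2 * a)) \<and> disj_bits (y - Suc (2 * a)) z}"
  unfolding splits_def by (subst card_Collect_parity) (auto intro: finite_splits)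

lemma splits_0 [simp]: "splits 0 x z = 1"
proof -
  have "{a. a \<le> 0 \<and> disj_bits x a \<and> disj_bits (0 - a) z} = {0}" by auto
  then show ?thesis by (simp add: splits_def)
qed

lemma splits_commute: "splits y x z = splits y z x"
  unfolding splits_def
  by (rule bij_betw_same_card [of "\<lambda>a. y - a"], rule bij_betw_byWitness [of _ "\<lambda>a. y - a"])
    (auto simp: disj_bits_commute)

lemma splits_Suc_double:
  "splits (Suc (2 * m)) x z = card {a. a \<le> m \<and> disj_bits x (2 * a) \<and> disj_bits (Suc (2 * (m - a))) z}
     + card {a. a \<le> m \<and> disj_bits x (Suc (2 * a)) \<and> disj_bits (2 * (m - a)) z}"
proof -
  have "2 * a \<le> Suc (2 * m) \<longleftrightarrow> a \<le> m" "Suc (2 * a) \<le> Suc (2 * m) \<longleftrightarrow> a \<le> m"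
    "Suc (2 * m) - Suc (2 * a) = 2 * (m - a)" "a \<le> m \<Longrightarrow> Suc (2 * m) - 2 * a = Suc (2 * (m - a))" for a
    by linarith+
  then show ?thesis
    by (simp only: splits_parity cong: conj_cong)
qed

lemma splits_double:
  "splits (2 * m) x z = card {a. a \<le> m \<and> disj_bits x (2 * a) \<and> disj_bits (2 * (m - a)) z}
     + card {a. a < m \<and> disj_bits x (Suc (2 * a)) \<and> disj_bits (Suc (2 * (m - Suc a))) z}"
proof -
  have "2 * a \<le> 2 * m \<longleftrightarrow> a \<le> m" "Suc (2 * a) \<le> 2 * m \<longleftrightarrow> a < m"
    "2 * m - 2 * a = 2 * (m - a)" "a < m \<Longrightarrow> 2 * m - Suc (2 * a) = Suc (2 * (m - Suc a))" for a
    by linarith+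
  then show ?thesis
    by (simp only: splits_parity cong: conj_cong)
qed

text \<open>For odd \<open>y\<close> exactly one of \<open>a\<close>, \<open>y - a\<close> is odd.
  Odd \<open>x\<close> excludes odd \<open>a\<close>, odd \<open>z\<close> excludes odd
  \<open>y - a\<close>, and each surviving parity class of \<open>a\<close> contributes
  \<open>splits m x z\<close>.\<close>

lemma splits_odd:
  "splits (Suc (2 * m)) (2 * x) (2 * z) = 2 * splits m x z"
  "splits (Suc (2 * m)) (Suc (2 * x)) (2 * z) = splits m x z"
  "splits (Suc (2 * m)) (2 * x) (Suc (2 * z)) = splits m x z"
  "splits (Suc (2 * m)) (Suc (2 * x)) (Suc (2 * z)) = 0"
  unfolding splits_Suc_double disj_bits_double by (simp_all add: splits_def)

text \<open>Now \<open>a\<close> and \<open>y - a\<close> have equal parity, and the odd class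
  survives only if \<open>x\<close> and \<open>z\<close> are both even. Its halves add up to one
  less because of the carry, hence the \<open>Suc m\<close> in the first rule.\<close>

lemma splits_even:
  "splits (2 * Suc m) (2 * x) (2 * z) = splits (Suc m) x z + splits m x z"
  "splits (2 * m) (Suc (2 * x)) (2 * z) = splits m x z"
  "splits (2 * m) (2 * x) (Suc (2 * z)) = splits m x z"
  "splits (2 * m) (Suc (2 * x)) (Suc (2 * z)) = splits m x z"
  unfolding splits_double disj_bits_double by (simp_all add: splits_def less_Suc_eq_le)

section \<open>Comparing counts at neighbouring points\<close>

text \<open>Lowering the total is a bridge: used for \<open>x\<close> and, by symmetry, for
  \<open>z\<close>, it compares both neighbours in \<open>splits_even_sum\<close> with the same
  \<open>splits k (Suc x) (Suc z)\<close>. Each parity case closes at once or follows from the claim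
  for the halves.\<close>

lemma splits_shift:
  "splits (Suc k) (Suc x) z = 0 \<Longrightarrow> splits (Suc k) x z = splits k (Suc x) z"
proof (induction k arbitrary: x z rule: less_induct)
  case (less k)
  obtain m where x: "x = 2 * m \<or> x = Suc (2 * m)" by (metis nat_parity_cases)
  obtain n where z: "z = 2 * n \<or> z = Suc (2 * n)" by (metis nat_parity_cases)
  show ?case
  proof (cases k rule: nat_parity_cases)
    case (1 j)
    show ?thesis
    proof (cases j)
      case 0
      with 1 x z less.prems show ?thesis
        using splits_odd [of 0] by (auto simp: double_Suc simp del: mult_Suc_right)
    next
      case (Suc i)
      with 1 have "i < k" by simp
      from less.IH [OF this, of m n] 1 x z Suc less.prems show ?thesis
        by (auto simp: double_Suc splits_odd splits_even simp del: mult_Suc_right)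
    qed
  next
    case (2 j)
    then have "j < k" by simp
    from less.IH [OF this, of m n] 2 x z less.prems show ?thesis
      by (auto simp: double_Suc splits_odd splits_even simp del: mult_Suc_right)
  qed
qed

text \<open>For even \<open>k\<close> halving contradicts the hypotheses. For odd \<open>k\<close>
  one halving shows a neighbour with count 1, except when \<open>x\<close> and \<open>z\<close> are
  both odd; then the hypotheses pass to the halves.\<close>

lemma splits_unique_shift:
  assumes "splits (Suc k) (Suc x) (Suc z) = 1" "splits k (Suc x) (Suc z) = 0"
  shows "splits (Suc k) x (Suc z) = 1 \<or> splits (Suc k) (Suc x) z = 1"
  using assms
proof (induction k arbitrary: x z rule: less_induct)
  case (less k)
  obtain m where x: "x = 2 * m \<or> x = Suc (2 * m)" by (metis nat_parity_cases)
  obtain n where z: "z = 2 * n \<or> z = Suc (2 * n)" by (metis nat_parity_cases)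
  show ?case
  proof (cases k rule: nat_parity_cases)
    case (1 j)
    with x z less.prems show ?thesis
      by (auto simp: double_Suc splits_odd splits_even simp del: mult_Suc_right)
  next
    case (2 j)
    then have "j < k" by simp
    from less.IH [OF this, of m n] 2 x z less.prems show ?thesis
      by (auto simp: double_Suc splits_odd splits_even simp del: mult_Suc_right)
  qed
qed

lemma splits_even_sum:
  assumes "even (x + z)"
  shows "splits y (Suc x) (Suc z) = 0 \<Longrightarrow> splits y x (Suc z) = splits y (Suc x) z"
    and "splits y (Suc x) (Suc z) = 1 \<Longrightarrow> splits y x (Suc z) = 1 \<or> splits y (Suc x) z = 1"
proof -
  show *: "splits y (Suc x) (Suc z) = 0 \<Longrightarrow> splits y x (Suc z) = splits y (Suc x) z" for y x z
  proof (cases y)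
    case (Suc k)
    assume "splits y (Suc x) (Suc z) = 0"
    with Suc splits_shift [of k x "Suc z"] splits_shift [of k z "Suc x"] show ?thesis
      by (simp add: splits_commute)
  qed simp
  assume one: "splits y (Suc x) (Suc z) = 1"
  from assms consider m n where "x = 2 * m" "z = 2 * n" | m n where "x = Suc (2 * m)" "z = Suc (2 * n)"
    by (metis nat_parity_cases even_add even_Suc dvd_triv_left)
  then show "splits y x (Suc z) = 1 \<or> splits y (Suc x) z = 1"
  proof cases
    case 1
    with one show ?thesis
      by (cases y rule: nat_parity_cases) (simp_all add: splits_odd splits_even)
  next
    case 2
    show ?thesis
    proof (cases y rule: nat_parity_cases)
      case (1 j)
      show ?thesis
      proof (cases j)
        case (Suc k)
        from one have sum: "splits (Suc k) (Suc m) (Suc n) + splits k (Suc m) (Suc n) = 1"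
          unfolding 1 2 Suc double_Suc splits_even .
        \<comment> \<open>Exactly one summand in \<open>sum\<close> is 1. If it is the first,
          \<open>splits_unique_shift\<close> applies; if the second, \<open>splits_shift\<close>
          carries its value to a neighbour.\<close>
        have "splits (Suc k) m (Suc n) = 1 \<or> splits (Suc k) (Suc m) n = 1"
        proof (cases "splits k (Suc m) (Suc n)")
          case 0
          with sum splits_unique_shift [of k m n] show ?thesis by simp
        next
          case Suc
          with sum splits_shift [of k m "Suc n"] show ?thesis by simp
        qed
        then show ?thesis
          unfolding 1 2 Suc double_Suc splits_even .
      qed (simp add: 1)
    next
      \<comment> \<open>An odd total with both outer arguments even has an even count, so not
        1.\<close>
      case (2 j)
      with \<open>x = Suc (2 * m)\<close> \<open>z = Suc (2 * n)\<close> one show ?thesis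
        by (simp add: double_Suc splits_odd del: mult_Suc_right)
    qed
  qed
qed

section \<open>Lower bounds for the count\<close>

lemma splits_0_even_ge_2:
  assumes "even z" "0 < y"
  shows "2 \<le> splits y 0 z"
proof -
  from assms obtain n where "z = 2 * n" by auto
  moreover have "disj_bits (Suc 0) (2 * n)" using disj_bits_double(2) [of 0 n] by simp
  ultimately have "{y, y - 1} \<subseteq> {a. a \<le> y \<and> disj_bits 0 a \<and> disj_bits (y - a) z}"
    using assms by auto
  then have "card {y, y - 1} \<le> splits y 0 z"
    unfolding splits_def by (intro card_mono finite_splits)
  with assms show ?thesis by simp
qed

definition zero_digits :: "nat \<Rightarrow> nat" where
  "zero_digits n = card {i. i < floorlog 2 n \<and> \<not> bit n i}"

lemma card_less_Suc_Collect:
  "card {i. i < Suc n \<and> P i} = (if P 0 then 1 else 0) + card {i. i < n \<and> P (Suc i)}"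
proof -
  have "{i. i < Suc n \<and> P i} = (if P 0 then {0} else {}) \<union> Suc ` {i. i < n \<and> P (Suc i)}"
    by (auto simp: less_Suc_eq_0_disj)
  moreover have "finite {i. i < n \<and> P (Suc i)}" by simp
  ultimately show ?thesis
    by (auto simp: card_image card_insert_if)
qed

lemma zero_digits_double:
  "0 < m \<Longrightarrow> zero_digits (2 * m) = Suc (zero_digits m)"
  "zero_digits (Suc (2 * m)) = zero_digits m"
  by (simp_all add: zero_digits_def compute_floorlog [of 2 "2 * m"] compute_floorlog [of 2 "Suc (2 * m)"]
      card_less_Suc_Collect bit_Suc bit_0)

text \<open>Supplies the positive carry term for the next bound. By disjointness \<open>x\<close>
  and \<open>z\<close> are both even for odd \<open>k\<close>, and exactly one is odd for even
  \<open>k\<close>.\<close>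

lemma splits_pred_pos:
  assumes "disj_bits x z" "x + z = Suc k"
  shows "0 < splits k x z"
  using assms
proof (induction k arbitrary: x z rule: less_induct)
  case (less k)
  obtain m where x: "x = 2 * m \<or> x = Suc (2 * m)" by (metis nat_parity_cases)
  obtain n where z: "z = 2 * n \<or> z = Suc (2 * n)" by (metis nat_parity_cases)
  show ?case
  proof (cases k rule: nat_parity_cases)
    case (1 j)
    with less.prems x z have d: "disj_bits m n" "m + n = j" and
      xz: "x = 2 * m \<and> z = Suc (2 * n) \<or> x = Suc (2 * m) \<and> z = 2 * n"
      by (auto, presburger+)
    \<comment> \<open>The complement \<open>j - n\<close> is \<open>m\<close>, so both conditions on
      \<open>n\<close> read \<open>disj_bits m n\<close>.\<close>
    from d have "n \<in> {a. a \<le> j \<and> disj_bits m a \<and> disj_bits (j - a) n}" by auto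
    then have "0 < splits j m n"
      unfolding splits_def by (metis card_gt_0_iff empty_iff finite_splits)
    with xz 1 show ?thesis by (auto simp: splits_even)
  next
    case (2 j)
    with less.prems x z have d: "disj_bits m n" "m + n = Suc j" "j < k" and xz: "x = 2 * m" "z = 2 * n"
      by (auto, presburger+)
    from less.IH [OF d(3,1,2)] 2 xz show ?thesis by (simp add: splits_odd)
  qed
qed

text \<open>Appending the digit 0 to \<open>y\<close> adds one zero digit, while the count gains a
  carry term that is positive by \<open>splits_pred_pos\<close>; appending the digit 1 changes
  neither.\<close>

lemma zero_digits_less_splits:
  assumes "disj_bits x z" "x + z = y" "0 < y"
  shows "zero_digits y < splits y x z"
  using assms
proof (induction y arbitrary: x z rule: less_induct)
  case (less y)
  obtain m where x: "x = 2 * m \<or> x = Suc (2 * m)" by (metis nat_parity_cases)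
  obtain n where z: "z = 2 * n \<or> z = Suc (2 * n)" by (metis nat_parity_cases)
  show ?case
  proof (cases y rule: nat_parity_cases)
    case (1 j)
    with less.prems obtain k where k: "j = Suc k" by (cases j) auto
    from 1 less.prems x z have d: "disj_bits m n" "m + n = j" and xz: "x = 2 * m" "z = 2 * n"
      by (auto, presburger+)
    from less.IH [of j m n] d 1 k have "zero_digits j < splits j m n" by simp
    moreover from splits_pred_pos [of m n k] d k have "0 < splits k m n" by simp
    ultimately have "zero_digits (2 * j) < splits j m n + splits k m n"
      using k by (simp add: zero_digits_double del: mult_Suc_right)
    then show ?thesis unfolding 1 xz k splits_even .
  next
    case (2 j)
    with less.prems x z have d: "disj_bits m n" "m + n = j" and
      xz: "x = 2 * m \<and> z = Suc (2 * n) \<or> x = Suc (2 * m) \<and> z = 2 * n"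
      by (auto, presburger+)
    have "zero_digits j < splits j m n"
    proof (cases "j = 0")
      case True
      then show ?thesis by (simp add: zero_digits_def floorlog_def)
    next
      case False
      with less.IH [of j m n] d 2 show ?thesis by simp
    qed
    with xz 2 show ?thesis by (auto simp: splits_odd zero_digits_double)
  qed
qed

text \<open>Such a \<open>y\<close> has at least two zero digits. The bound 3 leaves two splittings
  after the loss of one with equal factors.\<close>

lemma three_le_splits:
  assumes "\<not> zumkeller y" "disj_bits x z" "x + z = y" "0 < y"
  shows "3 \<le> splits y x z"
  using assms zero_digits_less_splits [of x z y] by (simp add: zumkeller_def zero_digits_def)

section \<open>Ulam words with few ones\<close>

lemma length_ulam_words: "w \<in> ulam_words n \<Longrightarrow> length w = n"
  by (subst (asm) ulam_words.simps) (auto split: if_splits)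

lemma is_ulam_iff_length: "is_ulam w \<longleftrightarrow> w \<in> ulam_words (length w)"
proof
  assume "w \<in> ulam_words (length w)"
  moreover have "ulam_words 0 = {}" by (subst ulam_words.simps) simp
  ultimately show "is_ulam w" unfolding is_ulam_def
    by (metis empty_iff less_one linorder_not_less)
qed (use length_ulam_words is_ulam_def in blast)

lemma not_is_ulam_Nil [simp]: "\<not> is_ulam []"
  by (simp add: is_ulam_iff_length ulam_words.simps [of 0])

lemma is_ulam_singleton [simp]: "is_ulam [b]"
  by (simp add: is_ulam_iff_length ulam_words.simps [of "Suc 0"])

text \<open>Positions stand for pairs because they can be located relative to the 1s. The endpoints
  drop out, as the empty word is not Ulam.\<close>

definition cuts :: "word \<Rightarrow> nat set" where
  "cuts w = {k. k \<le> length w \<and> is_ulam (take k w) \<and> is_ulam (drop k w) \<and> take k w \<noteq> drop k w}"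

lemma card_eq_1_iff_ex1: "card S = 1 \<longleftrightarrow> (\<exists>!p. p \<in> S)"
  unfolding One_nat_def card_1_singleton_iff by auto

text \<open>Each stage is determined by word length, and nonempty factors are shorter than
  \<open>w\<close>, so the index bounds of the recursion disappear.\<close>

lemma is_ulam_rec:
  assumes "2 \<le> length w"
  shows "is_ulam w \<longleftrightarrow> card (cuts w) = 1"
proof -
  let ?n = "length w"
  have ex: "(\<exists>i\<in>{..<?n}. u \<in> ulam_words i) \<longleftrightarrow> is_ulam u \<and> length u < ?n" for u
    by (metis is_ulam_iff_length length_ulam_words lessThan_iff)
  let ?S = "{p. is_ulam (fst p) \<and> is_ulam (snd p) \<and> fst p \<noteq> snd p \<and> w = fst p @ snd p}"
  have "is_ulam w \<longleftrightarrow> (\<exists>!p. (is_ulam (fst p) \<and> length (fst p) < ?n) \<and> (is_ulam (snd p) \<and> length (snd p) < ?n)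
      \<and> fst p \<noteq> snd p \<and> w = fst p @ snd p)"
    using assms by (simp only: is_ulam_iff_length [of w] ulam_words.simps [of ?n] ex) auto
  also have "\<dots> \<longleftrightarrow> (\<exists>!p. p \<in> ?S)"
  proof -
    have "length (fst p) < ?n \<and> length (snd p) < ?n" if "p \<in> ?S" for p
      using that by (cases p; cases "fst p"; cases "snd p") auto
    then have "(is_ulam (fst p) \<and> length (fst p) < ?n) \<and> (is_ulam (snd p) \<and> length (snd p) < ?n)
      \<and> fst p \<noteq> snd p \<and> w = fst p @ snd p \<longleftrightarrow> p \<in> ?S" for p
      by blast
    then show ?thesis by simp
  qed
  also have "\<dots> \<longleftrightarrow> card ?S = 1"
    by (rule card_eq_1_iff_ex1 [symmetric])
  also have "card ?S = card (cuts w)"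
    by (rule bij_betw_same_card [of "\<lambda>p. length (fst p)"],
        rule bij_betw_byWitness [of _ "\<lambda>k. (take k w, drop k w)"]) (auto simp: cuts_def)
  finally show ?thesis .
qed

section \<open>Words with at most one 1\<close>

definition one_one :: "nat \<Rightarrow> nat \<Rightarrow> word" where
  "one_one x z = replicate x False @ True # replicate z False"

lemma count_list_replicate: "count_list (replicate n a) b = (if a = b then n else 0)"
  by (induction n) auto

lemma count_list_zeros_ones [simp]:
  "count_list (replicate n False) True = 0"
  "count_list (one_one x z) True = 1"
  "count_list (two_ones x y z) True = 2"
  by (simp_all add: one_one_def two_ones_def count_list_replicate)

lemma one_one_eq_iff: "one_one x z = one_one x' z' \<longleftrightarrow> x = x' \<and> z = z'"
proof
  assume *: "one_one x z = one_one x' z'"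
  have "length (takeWhile Not (one_one x z)) = x" for x z
    by (simp add: one_one_def takeWhile_append)
  with * have "x = x'" by metis
  with * show "x = x' \<and> z = z'"
    by (simp add: one_one_def)
qed simp

text \<open>By induction a longer block could only be cut into two single zeros, which are equal.
  Hence cuts outside the 1s strip exactly one outer zero.\<close>

lemma is_ulam_zeros [simp]: "is_ulam (replicate n False) \<longleftrightarrow> n = 1"
proof (induction n rule: less_induct)
  case (less n)
  show ?case
  proof (cases "2 \<le> n")
    case True
    have "k = 1 \<and> n - k = 1" if "k \<in> cuts (replicate n False)" for k
    proof -
      from that have k: "k \<le> n" and u: "is_ulam (replicate k False)" "is_ulam (replicate (n - k) False)"
        by (auto simp: cuts_def)
      from u have "k \<noteq> 0" "n - k \<noteq> 0" by (metis not_is_ulam_Nil replicate_0)+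
      with k u less [of k] less [of "n - k"] show ?thesis by auto
    qed
    then have "cuts (replicate n False) = {}"
      by (fastforce simp: cuts_def)
    with True show ?thesis by (simp add: is_ulam_rec)
  next
    case False
    then have "n = 0 \<or> n = 1" by auto
    then show ?thesis by auto
  qed
qed

lemma split_one_one:
  assumes "k \<le> Suc (x + z)"
  obtains (left) "k \<le> x" "take k (one_one x z) = replicate k False" "drop k (one_one x z) = one_one (x - k) z"
  | (right) c where "k = Suc (x + c)" "c \<le> z" "take k (one_one x z) = one_one x c"
      "drop k (one_one x z) = replicate (z - c) False"
proof (cases "k \<le> x")
  case True
  then show ?thesis by (intro left) (auto simp: one_one_def)
next
  case False
  with assms show ?thesis by (intro right [of "k - Suc x"]) (auto simp: one_one_def take_Cons' drop_Cons' min_def)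
qed

lemma split_two_ones:
  assumes "k \<le> Suc (Suc (x + y + z))"
  obtains (left) "k \<le> x" "take k (two_ones x y z) = replicate k False" "drop k (two_ones x y z) = two_ones (x - k) y z"
  | (middle) a where "k = Suc (x + a)" "a \<le> y" "take k (two_ones x y z) = one_one x a"
      "drop k (two_ones x y z) = one_one (y - a) z"
  | (right) c where "k = Suc (Suc (x + y + c))" "c \<le> z" "take k (two_ones x y z) = two_ones x y c"
      "drop k (two_ones x y z) = replicate (z - c) False"
proof -
  consider "k \<le> x" | "x < k" "k \<le> Suc (x + y)" | "Suc (x + y) < k" by linarith
  then show ?thesis
  proof cases
    case 1
    then show ?thesis by (intro left) (auto simp: two_ones_def)
  next
    case 2
    then show ?thesis
      by (intro middle [of "k - Suc x"]) (auto simp: one_one_def two_ones_def take_Cons' drop_Cons' min_def)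
  next
    case 3
    with assms show ?thesis
      by (intro right [of "k - Suc (Suc (x + y))"])
        (auto simp: two_ones_def take_Cons' drop_Cons' min_def)
  qed
qed

lemma length_one_one [simp]: "length (one_one x z) = Suc (x + z)"
  by (simp add: one_one_def)

lemma length_two_ones [simp]: "length (two_ones x y z) = Suc (Suc (x + y + z))"
  by (simp add: two_ones_def)

lemma count_list_neq: "count_list u a \<noteq> count_list v a \<Longrightarrow> u \<noteq> v"
  by auto

lemma cuts_one_one:
  "cuts (one_one x z) =
    (if 0 < x \<and> is_ulam (one_one (x - 1) z) then {1} else {}) \<union>
    (if 0 < z \<and> is_ulam (one_one x (z - 1)) then {x + z} else {})" (is "_ = ?R")
proof (rule set_eqI)
  fix k
  show "k \<in> cuts (one_one x z) \<longleftrightarrow> k \<in> ?R"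
  proof (cases "k \<le> Suc (x + z)")
    case True
    then show ?thesis
    proof (cases rule: split_one_one)
      case left
      then have "take k (one_one x z) \<noteq> drop k (one_one x z)"
        by (intro count_list_neq [of _ True]) simp
      with left show ?thesis by (auto simp: cuts_def)
    next
      case (right c)
      then have "take k (one_one x z) \<noteq> drop k (one_one x z)"
        by (intro count_list_neq [of _ True]) simp
      moreover from right have "z - c = 1 \<longleftrightarrow> 0 < z \<and> c = z - 1" by auto
      ultimately show ?thesis using right by (auto simp: cuts_def)
    qed
  qed (auto simp: cuts_def)
qed

lemma is_ulam_one_one: "is_ulam (one_one x z) \<longleftrightarrow> disj_bits x z"
proof (induction "x + z" arbitrary: x z rule: less_induct)
  case less
  have rec: "is_ulam (one_one x z) \<longleftrightarrow> card (cuts (one_one x z)) = 1" if "0 < x + z"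
    by (rule is_ulam_rec) (unfold length_one_one, use that in linarith)
  consider "x = 0" "z = 0" | m where "x = Suc m" "z = 0" | n where "x = 0" "z = Suc n"
    | m n where "x = Suc m" "z = Suc n"
    by (metis not0_implies_Suc)
  then show ?case
  proof cases
    case 1
    then show ?thesis by (simp add: one_one_def)
  next
    \<comment> \<open>For positive \<open>x\<close> and \<open>z\<close> the cut positions 1 and
      \<open>x + z\<close> differ, so having exactly one cut is the exclusive or in
      \<open>disj_bits_pascal\<close>.\<close>
    case 4
    with less [of m z] less [of x n] rec show ?thesis
      by (auto simp: cuts_one_one disj_bits_pascal)
  qed (use less rec in \<open>auto simp: cuts_one_one\<close>)
qed

section \<open>Words with two 1s\<close>

text \<open>The summands count the cuts before, after and between the 1s. Equal factors need a
  middle cut with \<open>a = z\<close> and \<open>x = y - a\<close>; \<open>splits\<close> counts it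
  iff \<open>disj_bits x z\<close>, so the subtraction never truncates.\<close>

lemma is_ulam_two_ones_rec:
  "is_ulam (two_ones x y z) \<longleftrightarrow>
    of_bool (0 < x \<and> is_ulam (two_ones (x - 1) y z)) + of_bool (0 < z \<and> is_ulam (two_ones x y (z - 1)))
    + (splits y x z - of_bool (x + z = y \<and> disj_bits x z)) = (1 :: nat)"
proof -
  let ?M = "{a. a \<le> y \<and> disj_bits x a \<and> disj_bits (y - a) z}"
  let ?A = "if 0 < x \<and> is_ulam (two_ones (x - 1) y z) then {1} else {} :: nat set"
  let ?B = "(\<lambda>a. Suc (x + a)) ` (?M - (if x + z = y then {z} else {}))"
  let ?C = "if 0 < z \<and> is_ulam (two_ones x y (z - 1)) then {Suc (x + y + z)} else {} :: nat set"
  have "cuts (two_ones x y z) = ?A \<union> ?B \<union> ?C" (is "_ = ?R")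
  proof (rule set_eqI)
    fix k
    have R: "k \<in> ?R \<longleftrightarrow> k = 1 \<and> 0 < x \<and> is_ulam (two_ones (x - 1) y z)
      \<or> (\<exists>a\<le>y. k = Suc (x + a) \<and> disj_bits x a \<and> disj_bits (y - a) z \<and> \<not> (x = y - a \<and> a = z))
      \<or> k = Suc (x + y + z) \<and> 0 < z \<and> is_ulam (two_ones x y (z - 1))"
    proof -
      have "a \<in> ?M - (if x + z = y then {z} else {}) \<longleftrightarrow>
          a \<le> y \<and> disj_bits x a \<and> disj_bits (y - a) z \<and> \<not> (x = y - a \<and> a = z)" for a
        by (cases "x + z = y") auto
      then have "k \<in> ?B \<longleftrightarrow>
          (\<exists>a\<le>y. k = Suc (x + a) \<and> disj_bits x a \<and> disj_bits (y - a) z \<and> \<not> (x = y - a \<and> a = z))"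
        unfolding image_iff Bex_def by blast
      moreover have "k \<in> ?A \<longleftrightarrow> k = 1 \<and> 0 < x \<and> is_ulam (two_ones (x - 1) y z)"
        "k \<in> ?C \<longleftrightarrow> k = Suc (x + y + z) \<and> 0 < z \<and> is_ulam (two_ones x y (z - 1))"
        by simp_all
      ultimately show ?thesis unfolding Un_iff by blast
    qed
    show "k \<in> cuts (two_ones x y z) \<longleftrightarrow> k \<in> ?R"
    proof (cases "k \<le> Suc (Suc (x + y + z))")
      case True
      then show ?thesis
      proof (cases rule: split_two_ones)
        case left
        then have "take k (two_ones x y z) \<noteq> drop k (two_ones x y z)"
          by (intro count_list_neq [of _ True]) simp
        then have "k \<in> cuts (two_ones x y z) \<longleftrightarrow> k = 1 \<and> 0 < x \<and> is_ulam (two_ones (x - 1) y z)"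
          using left by (auto simp: cuts_def)
        moreover have "k \<noteq> Suc (x + y + z)" "\<forall>b\<le>y. k \<noteq> Suc (x + b)"
          using left(1) by auto
        ultimately show ?thesis unfolding R by blast
      next
        case (middle a)
        then have "k \<in> cuts (two_ones x y z) \<longleftrightarrow> disj_bits x a \<and> disj_bits (y - a) z \<and> \<not> (x = y - a \<and> a = z)"
          by (simp add: cuts_def is_ulam_one_one one_one_eq_iff)
        moreover have "\<not> (k = 1 \<and> 0 < x)" "\<not> (k = Suc (x + y + z) \<and> 0 < z)"
          using middle(1,2) by auto
        moreover have "(\<exists>b\<le>y. k = Suc (x + b) \<and> P b) \<longleftrightarrow> P a" for P
          using middle(1,2) by auto
        ultimately show ?thesis unfolding R by auto
      next
        case (right c)
        then have "take k (two_ones x y z) \<noteq> drop k (two_ones x y z)"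
          by (intro count_list_neq [of _ True]) simp
        moreover from right have "z - c = 1 \<longleftrightarrow> 0 < z \<and> c = z - 1" by auto
        ultimately have "k \<in> cuts (two_ones x y z) \<longleftrightarrow> k = Suc (x + y + z) \<and> 0 < z \<and> is_ulam (two_ones x y (z - 1))"
          using right by (auto simp: cuts_def)
        moreover have "k \<noteq> 1" "\<forall>b\<le>y. k \<noteq> Suc (x + b)"
          using right(1) by auto
        ultimately show ?thesis unfolding R by blast
      qed
    qed (auto simp: cuts_def)
  qed
  moreover have fin: "finite ?M" by (rule finite_splits)
  \<comment> \<open>The families lie in disjoint ranges: up to \<open>x\<close>, from
    \<open>Suc x\<close> to \<open>Suc (x + y)\<close>, and beyond.\<close>
  moreover have "card (?A \<union> ?B \<union> ?C) = card ?A + card ?B + card ?C"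
  proof -
    have "card (A \<union> B \<union> C) = card A + card B + card C"
      if "finite A" "finite B" "finite C" "(A \<union> B) \<inter> C = {}" "A \<inter> B = {}" for A B C :: "nat set"
      using that by (simp add: card_Un_disjoint)
    then show ?thesis
    proof this
      show "finite ?A" "finite ?B" "finite ?C" using fin by auto
      show "(?A \<union> ?B) \<inter> ?C = {}" "?A \<inter> ?B = {}" by auto
    qed
  qed
  moreover have "card ?B = splits y x z - of_bool (x + z = y \<and> disj_bits x z)"
    using fin by (subst card_image) (auto simp: splits_def card_Diff_singleton_if inj_on_def)
  moreover have "card ?A = of_bool (0 < x \<and> is_ulam (two_ones (x - 1) y z))"
    "card ?C = of_bool (0 < z \<and> is_ulam (two_ones x y (z - 1)))" by auto
  moreover have "is_ulam (two_ones x y z) \<longleftrightarrow> card (cuts (two_ones x y z)) = 1"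
    by (rule is_ulam_rec) simp
  ultimately show ?thesis by (simp only: ac_simps)
qed

lemma c_Ulam_eq: "c_Ulam y (x, z) = min 2 (splits y x z)"
proof -
  let ?M = "{a. a \<le> y \<and> disj_bits x a \<and> disj_bits (y - a) z}"
  have "{(u, v). is_ulam u \<and> is_ulam v \<and> count_list u True = 1 \<and> count_list v True = 1 \<and> u @ v = two_ones x y z}
      = (\<lambda>a. (one_one x a, one_one (y - a) z)) ` ?M" (is "?L = ?f ` _")
  proof (intro set_eqI iffI)
    fix p assume "p \<in> ?L"
    then obtain u v where p: "p = (u, v)" and uv: "is_ulam u" "is_ulam v" "count_list u True = 1"
      "count_list v True = 1" "u @ v = two_ones x y z" by auto
    have u: "take (length u) (two_ones x y z) = u" and v: "drop (length u) (two_ones x y z) = v"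
      unfolding uv(5) [symmetric] by simp_all
    have "length u \<le> Suc (Suc (x + y + z))"
      using arg_cong [OF uv(5), of length] by simp
    then show "p \<in> ?f ` ?M"
    proof (cases rule: split_two_ones)
      case left
      then have "u = replicate (length u) False" unfolding u by simp
      then have "count_list u True = 0" by (metis count_list_zeros_ones(1))
      with uv(3) show ?thesis by simp
    next
      case (middle a)
      then have "u = one_one x a" "v = one_one (y - a) z" unfolding u v by simp_all
      with uv(1,2) p \<open>a \<le> y\<close> show ?thesis by (simp add: is_ulam_one_one)
    next
      case (right c)
      then have "v = replicate (z - c) False" unfolding v by simp
      with uv(4) show ?thesis by simp
    qed
  next
    fix p assume "p \<in> ?f ` ?M"
    then obtain a where a: "p = ?f a" "a \<le> y" "disj_bits x a" "disj_bits (y - a) z" by auto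
    have "one_one x a @ one_one (y - a) z = two_ones x y z"
      using a(2) by (simp add: one_one_def two_ones_def replicate_add [symmetric])
    with a show "p \<in> ?L" by (simp add: is_ulam_one_one)
  qed
  moreover have "inj_on ?f ?M" by (auto simp: inj_on_def one_one_eq_iff)
  ultimately show ?thesis by (simp add: c_Ulam_def splits_def card_image)
qed

lemma is_ulam_two_ones:
  assumes "\<not> zumkeller y"
  shows "is_ulam (two_ones x y z) \<longleftrightarrow> odd (x + z) \<and> splits y x z = 1"
proof (induction "x + z" arbitrary: x z rule: less_induct)
  case less
  let ?m = "splits y x z - of_bool (x + z = y \<and> disj_bits x z)"
  have three: "3 \<le> splits y x z" if "x + z = y \<and> disj_bits x z" "0 < y"
    using three_le_splits [OF assms] that by blast
  show ?case
  proof (cases "odd (x + z)")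
    case True
    then have "(0 < x \<and> is_ulam (two_ones (x - 1) y z)) = False"
      "(0 < z \<and> is_ulam (two_ones x y (z - 1))) = False"
      using less [of "x - 1" z] less [of x "z - 1"] by auto
    then have "is_ulam (two_ones x y z) \<longleftrightarrow> ?m = 1"
      by (subst is_ulam_two_ones_rec) (simp only: of_bool_eq add_0)
    \<comment> \<open>If a splitting is spoiled, then \<open>y = x + z\<close> is odd, hence
      positive, and \<open>three\<close> makes both sides false.\<close>
    also have "\<dots> \<longleftrightarrow> splits y x z = 1"
      using three True by (cases "x + z = y \<and> disj_bits x z") (auto dest: odd_pos)
    finally show ?thesis using True by simp
  next
    case False
    then have neighbours:
      "(0 < x \<and> is_ulam (two_ones (x - 1) y z)) \<longleftrightarrow> 0 < x \<and> splits y (x - 1) z = 1"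
      "(0 < z \<and> is_ulam (two_ones x y (z - 1))) \<longleftrightarrow> 0 < z \<and> splits y x (z - 1) = 1"
      using less [of "x - 1" z] less [of x "z - 1"] by auto
    have "of_bool (0 < x \<and> splits y (x - 1) z = 1) + of_bool (0 < z \<and> splits y x (z - 1) = 1) + ?m \<noteq> (1 :: nat)"
    proof (cases "0 < y \<and> x + z = y \<and> disj_bits x z")
      case True
      with three show ?thesis by simp
    next
      case noncorr: False
      consider "y = 0" | "0 < y" "x = 0 \<or> z = 0" | "0 < x" "0 < z" by linarith
      then show ?thesis
      proof cases
        \<comment> \<open>The count is 1 here. For \<open>x = z = 0\<close> this cut is spoiled and
          the total is 0; otherwise each positive outer block adds an end cut.\<close>
        case 1
        then show ?thesis using False by (cases "x = 0"; cases "z = 0") (auto simp: of_bool_def)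
      next
        case 2
        with False have "2 \<le> splits y x z"
          using splits_0_even_ge_2 [of z y] splits_0_even_ge_2 [of x y] splits_commute [of y x z] by auto
        with 2 noncorr show ?thesis by auto
      next
        case 3
        then obtain i j where ij: "x = Suc i" "z = Suc j" by (metis gr0_implies_Suc)
        with False have "even (i + j)" by simp
        note splits_even_sum [OF this, of y]
        moreover from ij noncorr have "?m = splits y x z" by auto
        \<comment> \<open>With count 0 the end cuts occur both or not at all; with count 1 at least
          one joins; larger counts already exceed 1.\<close>
        ultimately show ?thesis using ij by (cases "splits y x z = 0") (auto simp: of_bool_def)
      qed
    qed
    then show ?thesis
      using False by (subst is_ulam_two_ones_rec) (simp only: neighbours, simp)
  qed
qed

theorem theorem1p5:
  fixes y :: nat
  assumes "\<not> zumkeller y"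
  shows "Ulam y = {(x, z). [x + z = 1] (mod 2) \<and> c_Ulam y (x, z) = 1}"
proof -
  have "[x + z = 1] (mod 2) \<longleftrightarrow> odd (x + z)" for x z :: nat
    unfolding cong_def odd_iff_mod_2_eq_one by simp
  moreover have "c_Ulam y (x, z) = 1 \<longleftrightarrow> splits y x z = 1" for x z
    by (simp add: c_Ulam_eq min_def)
  ultimately show ?thesis
    using is_ulam_two_ones [OF assms] by (simp add: Ulam_def)
qed

end
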